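(* Let $(X,d)$ be a nonempty compact metric space and $f:X\to X$ a homeomorphism. Assume that $(X,f)$ has the periodic gluing orbit property and that $X$ does not consist of a single periodic orbit. Then $(X,f)$ has positive topological entropy, $h(f)>0$, and exponential growth of periodic orbits, i.e. $p(f)>0$.
   Context: Periodic gluing orbit property. An orbit sequence of rank $k$ ($k\ge 1$) is a finite sequence $\mathscr{C}=\{(x_j,m_j)\in X\times\mathbb{Z}^+: j=1,\dots,k\}$, where $\mathbb{Z}^+=\{1,2,\dots\}$. A gap for it is a $(k-1)$-tuple $\mathscr{G}=\{t_j\in\mathbb{Z}^+: j=1,\dots,k-1\}$ (empty if $k=1$). For $\varepsilon>0$, $(\mathscr{C},\mathscr{G})$ is $\varepsilon$-shadowed by $z\in X$ if for every $j=1,\dots,k$, $d(f^{s_j+l}(z),f^l(x_j))<\varepsilon$ for every $l=0,1,\dots,m_j-1$, where $s_1=0$ and $s_j=\sum_{i=1}^{j-1}(m_i+t_i-1)$ for $j=2,\dots,k$. $(X,f)$ has the periodic gluing orbit property if for every $\varepsilon>0$ there is $M(\varepsilon)>0$ such that for any orbit sequence $\mathscr{C}$ of any rank $k$ there are an integer $t$ with $0\le t\le M(\varepsilon)$ and a gap $\mathscr{G}$ with $\max\mathscr{G}\le M(\varepsilon)$ (no condition if $\mathscr{G}$ is empty) such that $(\mathscr{C},\mathscr{G})$ is $\varepsilon$-shadowed by a periodic point $z$ of period $s_k+m_k+t$, i.e. $f^{s_k+m_k+t}(z)=z$ (not necessarily the least period). Growth of periodic orbits: $P_n(f)$ is the set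 of periodic points of $f$ with periods no more than $n$, $p_n(f)$ is its cardinality (possibly $\infty$), and $p(f)=\limsup_{n\to\infty}\frac{\ln p_n(f)}{n}\in[-\infty,\infty]$. $h(f)$ denotes topological entropy. *)

theory Defs
  imports "HOL-Analysis.Analysis"
begin

section \<open>Periodic points and their growth\<close>

definition has_period :: "('a \<Rightarrow> 'a) \<Rightarrow> nat \<Rightarrow> 'a \<Rightarrow> bool" where
  "has_period f p x \<longleftrightarrow> p \<ge> 1 \<and> (f ^^ p) x = x"

definition single_periodic_orbit :: "'a set \<Rightarrow> ('a \<Rightarrow> 'a) \<Rightarrow> bool" where
  "single_periodic_orbit X f \<longleftrightarrow>
     (\<exists>x\<in>X. \<exists>p. has_period f p x \<and> X = {(f ^^ i) x | i. i < p})"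

definition periodic_points_upto :: "'a set \<Rightarrow> ('a \<Rightarrow> 'a) \<Rightarrow> nat \<Rightarrow> 'a set" where
  "periodic_points_upto X f n = {x \<in> X. \<exists>p\<le>n. has_period f p x}"

definition ecard :: "'a set \<Rightarrow> enat" where
  "ecard A = (if finite A then enat (card A) else \<infinity>)"

definition ln_enat :: "enat \<Rightarrow> ereal" where
  "ln_enat N = (case N of enat k \<Rightarrow> (if k = 0 then -\<infinity> else ereal (ln (real k))) | \<infinity> \<Rightarrow> \<infinity>)"

definition periodic_growth :: "'a set \<Rightarrow> ('a \<Rightarrow> 'a) \<Rightarrow> ereal" where
  "periodic_growth X f =
     limsup (\<lambda>n. ln_enat (ecard (periodic_points_upto X f n)) / ereal (real n))"


section \<open>Topological entropy\<close>

text \<open>Bowen's definition through separated sets, as the limit, for \<open>\<epsilon>\<close> tending to 0 from above,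
  of the exponential growth rate in \<open>n\<close> of the maximal cardinality of an \<open>(n, \<epsilon>)\<close>-separated set.\<close>

definition separated_set ::
    "'a::metric_space set \<Rightarrow> ('a \<Rightarrow> 'a) \<Rightarrow> nat \<Rightarrow> real \<Rightarrow> 'a set \<Rightarrow> bool" where
  "separated_set X f n \<epsilon> E \<longleftrightarrow>
     E \<subseteq> X \<and> (\<forall>x\<in>E. \<forall>y\<in>E. x \<noteq> y \<longrightarrow> (\<exists>l<n. dist ((f ^^ l) x) ((f ^^ l) y) > \<epsilon>))"

definition separated_number ::
    "'a::metric_space set \<Rightarrow> ('a \<Rightarrow> 'a) \<Rightarrow> nat \<Rightarrow> real \<Rightarrow> enat" where
  "separated_number X f n \<epsilon> = (SUP E\<in>{E. separated_set X f n \<epsilon> E}. ecard E)"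

definition entropy_at_scale :: "'a::metric_space set \<Rightarrow> ('a \<Rightarrow> 'a) \<Rightarrow> real \<Rightarrow> ereal" where
  "entropy_at_scale X f \<epsilon> = limsup (\<lambda>n. ln_enat (separated_number X f n \<epsilon>) / ereal (real n))"

definition topological_entropy :: "'a::metric_space set \<Rightarrow> ('a \<Rightarrow> 'a) \<Rightarrow> ereal" where
  "topological_entropy X f = Lim (at_right 0) (entropy_at_scale X f)"

text \<open>The limit exists by monotonicity, and it is a supremum.\<close>

lemma ln_enat_mono: "M \<le> N \<Longrightarrow> ln_enat M \<le> ln_enat N"
  by (cases M; cases N) (auto simp: ln_enat_def)

lemma entropy_at_scale_antimono:
  assumes "\<epsilon> \<le> \<delta>"
  shows "entropy_at_scale X f \<delta> \<le> entropy_at_scale X f \<epsilon>"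
proof -
  have "separated_number X f n \<delta> \<le> separated_number X f n \<epsilon>" for n
    unfolding separated_number_def using assms
    by (intro SUP_subset_mono) (fastforce simp: separated_set_def)+
  then have "ln_enat (separated_number X f n \<delta>) / ereal (real n)
      \<le> ln_enat (separated_number X f n \<epsilon>) / ereal (real n)" if "n > 0" for n
    using that by (intro ereal_divide_right_mono ln_enat_mono) auto
  then show ?thesis
    unfolding entropy_at_scale_def
    by (intro Limsup_mono eventually_mono[OF eventually_gt_at_top[of 0]])
qed

lemma entropy_at_scale_tendsto:
  "(entropy_at_scale X f \<longlongrightarrow> (SUP \<epsilon>\<in>{0<..}. entropy_at_scale X f \<epsilon>)) (at_right 0)"
proof (rule order_tendstoI)
  fix a assume "a < (SUP \<epsilon>\<in>{0<..}. entropy_at_scale X f \<epsilon>)"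
  then obtain \<delta> where \<delta>: "\<delta> > 0" "a < entropy_at_scale X f \<delta>"
    by (auto simp: less_SUP_iff)
  have "a < entropy_at_scale X f \<epsilon>" if "\<epsilon> < \<delta>" for \<epsilon>
    using \<delta>(2) entropy_at_scale_antimono[of \<epsilon> \<delta> X f] that by (meson less_imp_le less_le_trans)
  then show "\<forall>\<^sub>F \<epsilon> in at_right 0. a < entropy_at_scale X f \<epsilon>"
    using \<delta>(1) by (auto simp: eventually_at_right[of 0 1])
next
  fix a assume a: "(SUP \<epsilon>\<in>{0<..}. entropy_at_scale X f \<epsilon>) < a"
  have "entropy_at_scale X f \<epsilon> < a" if "\<epsilon> > 0" for \<epsilon>
    using that by (intro le_less_trans[OF _ a] SUP_upper) auto
  then show "\<forall>\<^sub>F \<epsilon> in at_right 0. entropy_at_scale X f \<epsilon> < a"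
    using eventually_at_right_less[of "0::real"] by (auto elim: eventually_mono)
qed

lemma topological_entropy_eq_SUP:
  "topological_entropy X f = (SUP \<epsilon>\<in>{0<..}. entropy_at_scale X f \<epsilon>)"
  unfolding topological_entropy_def
  by (intro tendsto_Lim entropy_at_scale_tendsto) simp


section \<open>The periodic gluing orbit property\<close>

text \<open>Orbit sequences and gaps are lists, so indices start at 0 rather than 1.\<close>

definition orbit_sequence :: "'a set \<Rightarrow> ('a \<times> nat) list \<Rightarrow> bool" where
  "orbit_sequence X C \<longleftrightarrow> C \<noteq> [] \<and> (\<forall>(x, m) \<in> set C. x \<in> X \<and> m \<ge> 1)"

definition is_gap :: "('a \<times> nat) list \<Rightarrow> nat list \<Rightarrow> bool" where
  "is_gap C G \<longleftrightarrow> length G = length C - 1 \<and> (\<forall>t \<in> set G. t \<ge> 1)"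

text \<open>The subtraction does not truncate for orbit sequences and gaps, all entries being positive.\<close>

definition start_time :: "('a \<times> nat) list \<Rightarrow> nat list \<Rightarrow> nat \<Rightarrow> nat" where
  "start_time C G j = (\<Sum>i<j. snd (C ! i) + G ! i - 1)"

definition shadowed ::
    "('a::metric_space \<Rightarrow> 'a) \<Rightarrow> real \<Rightarrow> ('a \<times> nat) list \<Rightarrow> nat list \<Rightarrow> 'a \<Rightarrow> bool" where
  "shadowed f \<epsilon> C G z \<longleftrightarrow>
     (\<forall>j < length C. \<forall>l < snd (C ! j).
        dist ((f ^^ (start_time C G j + l)) z) ((f ^^ l) (fst (C ! j))) < \<epsilon>)"

definition periodic_gluing_orbit_property :: "'a::metric_space set \<Rightarrow> ('a \<Rightarrow> 'a) \<Rightarrow> bool" where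
  "periodic_gluing_orbit_property X f \<longleftrightarrow>
     (\<forall>\<epsilon>>0. \<exists>M::real. M > 0 \<and>
        (\<forall>C. orbit_sequence X C \<longrightarrow>
           (\<exists>(t::nat) G z. real t \<le> M \<and> is_gap C G \<and> (\<forall>g \<in> set G. real g \<le> M) \<and>
              z \<in> X \<and> shadowed f \<epsilon> C G z \<and>
              has_period f (start_time C G (length C - 1) + snd (last C) + t) z)))"

end

theory Submission
  imports Defs
begin

text \<open>
  Shadowing a one-segment orbit sequence gives a periodic point \<open>p\<close>.  As \<open>X\<close> is not its orbit,
  some \<open>q \<in> X\<close> stays at a positive distance \<open>5 * \<epsilon>\<close> or more from that orbit.  Let \<open>K\<close> bound all gaps
  at the scale \<open>\<epsilon>\<close>.

  The difficulty with gluing is that the gaps are not under control: gluing all words of length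
  \<open>k\<close> over an alphabet of orbit segments produces many orbits, but the segments may sit at different
  times in different orbits, so that distinct words need not give separated orbits.  There are,
  however, at most \<open>(K + 1) ^ k\<close> patterns of gaps, the time to close up included.  Over an alphabet
  of \<open>2 * (K + 1)\<close> segments, some pattern is therefore shared by at least \<open>2 ^ k\<close> words, and the orbits of these words are aligned:
  they have a common period, at most linear in \<open>k\<close>, and they are \<open>\<epsilon>\<close>-separated within it
  (\<open>glued_words\<close>).  This gives positive entropy and exponentially many periodic points at once.

  For this argument the alphabet has to be larger than \<open>K\<close>, which itself depends on the scale; so
  arbitrarily many segments of equal length are needed that are separated at a fixed scale
  (\<open>many_separated_segments\<close>).  They come from the same pair \<open>p\<close>, \<open>q\<close>: an orbit that follows \<open>p\<close> for
  the time \<open>a\<close> and then visits \<open>q\<close> does so at a time in \<open>{a..<a + K}\<close>, and orbits with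
  \<open>a = K, 2 * K, 3 * K, \<dots>\<close> are told apart by their times of first visit.
\<close>

section \<open>Gluing with a fixed bound at a fixed scale\<close>

text \<open>Gaps and closing times are bounded by a natural number here, so that they can be counted.\<close>

definition glues_within :: "'a::metric_space set \<Rightarrow> ('a \<Rightarrow> 'a) \<Rightarrow> real \<Rightarrow> nat \<Rightarrow> bool" where
  "glues_within X f \<epsilon> K \<longleftrightarrow>
     (\<forall>C. orbit_sequence X C \<longrightarrow>
        (\<exists>t G z. t \<le> K \<and> is_gap C G \<and> set G \<subseteq> {..K} \<and> z \<in> X \<and> shadowed f \<epsilon> C G z \<and>
           has_period f (start_time C G (length C - 1) + snd (last C) + t) z))"

lemma glues_withinE:
  assumes "glues_within X f \<epsilon> K" and "orbit_sequence X C"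
  obtains t G z where "t \<le> K" "is_gap C G" "set G \<subseteq> {..K}" "z \<in> X" "shadowed f \<epsilon> C G z"
    "has_period f (start_time C G (length C - 1) + snd (last C) + t) z"
  using assms unfolding glues_within_def by blast

lemma glues_within_mono:
  assumes "glues_within X f \<epsilon> K" and "K \<le> L"
  shows "glues_within X f \<epsilon> L"
  unfolding glues_within_def
proof (intro allI impI)
  fix C assume "orbit_sequence X C"
  from glues_withinE[OF assms(1) this] obtain t G z
    where "t \<le> K" "is_gap C G" "set G \<subseteq> {..K}" "z \<in> X" "shadowed f \<epsilon> C G z"
      "has_period f (start_time C G (length C - 1) + snd (last C) + t) z" .
  moreover from this assms(2) have "t \<le> L" "set G \<subseteq> {..L}" by auto
  ultimately show "\<exists>t G z. t \<le> L \<and> is_gap C G \<and> set G \<subseteq> {..L} \<and> z \<in> X \<and> shadowed f \<epsilon> C G z \<and>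
      has_period f (start_time C G (length C - 1) + snd (last C) + t) z"
    by blast
qed

lemma periodic_gluing_imp_glues_within:
  assumes "periodic_gluing_orbit_property X f" and "\<epsilon> > 0"
  obtains K where "K \<ge> 1" "glues_within X f \<epsilon> K"
proof -
  from assms obtain M :: real where
    M: "\<And>C. orbit_sequence X C \<Longrightarrow> \<exists>(t::nat) G z. real t \<le> M \<and> is_gap C G \<and>
          (\<forall>g \<in> set G. real g \<le> M) \<and> z \<in> X \<and> shadowed f \<epsilon> C G z \<and>
          has_period f (start_time C G (length C - 1) + snd (last C) + t) z"
    unfolding periodic_gluing_orbit_property_def by meson
  have le: "i \<le> nat \<lfloor>M\<rfloor>" if "real i \<le> M" for i
    using that by (simp add: le_nat_floor)
  have "glues_within X f \<epsilon> (nat \<lfloor>M\<rfloor>)"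
    unfolding glues_within_def
  proof (intro allI impI)
    fix C assume "orbit_sequence X C"
    from M[OF this] obtain t :: nat and G z where "real t \<le> M" "is_gap C G"
      "\<forall>g \<in> set G. real g \<le> M" "z \<in> X" "shadowed f \<epsilon> C G z"
      "has_period f (start_time C G (length C - 1) + snd (last C) + t) z"
      by blast
    moreover from this have "t \<le> nat \<lfloor>M\<rfloor>" "set G \<subseteq> {..nat \<lfloor>M\<rfloor>}"
      using le by auto
    ultimately show "\<exists>t G z. t \<le> nat \<lfloor>M\<rfloor> \<and> is_gap C G \<and> set G \<subseteq> {..nat \<lfloor>M\<rfloor>} \<and> z \<in> X \<and>
        shadowed f \<epsilon> C G z \<and> has_period f (start_time C G (length C - 1) + snd (last C) + t) z"
      by blast
  qed
  then have "glues_within X f \<epsilon> (Suc (nat \<lfloor>M\<rfloor>))"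
    by (rule glues_within_mono) simp
  then show thesis
    using that[of "Suc (nat \<lfloor>M\<rfloor>)"] by simp
qed

section \<open>Arbitrarily many segments separated at a fixed scale\<close>

lemma periodic_point_off_some_point:
  assumes "f ` X \<subseteq> X" and "X \<noteq> {}" and "periodic_gluing_orbit_property X f"
    and "\<not> single_periodic_orbit X f"
  obtains p q \<epsilon> where "p \<in> X" "q \<in> X" "\<epsilon> > 0" "\<And>i. dist ((f ^^ i) p) q \<ge> 5 * \<epsilon>"
proof -
  from assms(2) obtain x where "x \<in> X" by blast
  then have "orbit_sequence X [(x, 1)]"
    by (simp add: orbit_sequence_def)
  moreover obtain K where "glues_within X f 1 K"
    using periodic_gluing_imp_glues_within[OF assms(3), of 1] by auto
  ultimately obtain p P where p: "p \<in> X" "has_period f P p"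
    by (blast elim: glues_withinE)
  define orb where "orb = {(f ^^ i) p | i. i < P}"
  have in_orb: "(f ^^ i) p \<in> orb" for i
  proof -
    have "(f ^^ i) p = (f ^^ (i mod P)) p" and "i mod P < P"
      using p(2) by (auto simp: has_period_def funpow_mod_eq)
    then show ?thesis unfolding orb_def by blast
  qed
  have "(f ^^ i) p \<in> X" for i
    using p(1) assms(1) by (induction i) auto
  then have "orb \<subseteq> X"
    by (auto simp: orb_def)
  moreover have "X \<noteq> orb"
    using assms(4) p unfolding single_periodic_orbit_def orb_def by blast
  ultimately obtain q where q: "q \<in> X" "q \<notin> orb" by blast
  have "finite orb" by (simp add: orb_def)
  then obtain d where d: "d > 0" "\<And>y. y \<in> orb \<Longrightarrow> d \<le> dist q y"
    using finite_set_avoid[of orb q] q(2) by metis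
  show thesis
    using that[of p q "d / 5"] p(1) q(1) d in_orb by (simp add: dist_commute)
qed

lemma dist_quadrangle:
  fixes a b c d :: "'a::metric_space"
  shows "dist a d \<le> dist a b + dist b c + dist c d"
  using dist_triangle[of a d b] dist_triangle[of b d c] by linarith

text \<open>The number \<open>A\<close> of segments may be chosen after \<open>\<epsilon>\<close> and \<open>K\<close>.  The \<open>i\<close>-th one
  follows \<open>p\<close> for the time \<open>(i + 1) * K\<close> before it visits \<open>q\<close>; this visit takes place while the
  \<open>j\<close>-th one, for \<open>j > i\<close>, still follows \<open>p\<close>.\<close>

lemma many_separated_segments:
  fixes X :: "'a::metric_space set" and A :: nat
  assumes glue: "glues_within X f \<epsilon> K" and "K \<ge> 1" and "p \<in> X" "q \<in> X"
    and far: "\<And>i. dist ((f ^^ i) p) q \<ge> 5 * \<epsilon>"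
  shows "\<exists>m\<ge>1. \<exists>y. (\<forall>i. y i \<in> X) \<and>
    (\<forall>i<A. \<forall>j<A. i \<noteq> j \<longrightarrow> (\<exists>l<m. dist ((f ^^ l) (y i)) ((f ^^ l) (y j)) > 3 * \<epsilon>))"
proof -
  have "\<exists>z s. z \<in> X \<and> s < Suc a * K + K \<and> Suc a * K \<le> s \<and> dist ((f ^^ s) z) q < \<epsilon> \<and>
      (\<forall>l < Suc a * K. dist ((f ^^ l) z) ((f ^^ l) p) < \<epsilon>)" for a
  proof -
    let ?C = "[(p, Suc a * K), (q, 1)]"
    have "orbit_sequence X ?C"
      using assms by (simp add: orbit_sequence_def)
    then obtain G z
      where G: "is_gap ?C G" "set G \<subseteq> {..K}" and z: "z \<in> X" "shadowed f \<epsilon> ?C G z"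
      by (rule glues_withinE[OF glue])
    then obtain g where g: "G = [g]" "g \<ge> 1" "g \<le> K"
      by (auto simp: is_gap_def length_Suc_conv)
    have "dist ((f ^^ l) z) ((f ^^ l) p) < \<epsilon>" if "l < Suc a * K" for l
      using z(2)[unfolded shadowed_def, rule_format, of 0 l] that by (simp add: start_time_def)
    moreover have "dist ((f ^^ (Suc a * K + g - 1)) z) q < \<epsilon>"
      using z(2)[unfolded shadowed_def, rule_format, of 1 0] by (simp add: start_time_def g(1))
    moreover have "Suc a * K \<le> Suc a * K + g - 1" "Suc a * K + g - 1 < Suc a * K + K"
      using g by linarith+
    ultimately show ?thesis
      using z(1) by blast
  qed
  then obtain z s where z: "\<And>a. z a \<in> X"
    and s: "\<And>a. s a < Suc a * K + K" "\<And>a. Suc a * K \<le> s a"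
    and near_q: "\<And>a. dist ((f ^^ s a) (z a)) q < \<epsilon>"
    and near_p: "\<And>a l. l < Suc a * K \<Longrightarrow> dist ((f ^^ l) (z a)) ((f ^^ l) p) < \<epsilon>"
    by metis
  have sep: "dist ((f ^^ s i) (z i)) ((f ^^ s i) (z j)) > 3 * \<epsilon> \<and> s i < Suc A * K"
    if "i < j" "j < A" for i j
  proof -
    have "Suc i * K + K \<le> Suc j * K" "Suc i * K + K \<le> Suc A * K"
      using that mult_le_mono1[of "Suc (Suc i)" "Suc j" K]
        mult_le_mono1[of "Suc (Suc i)" "Suc A" K] by simp_all
    with s(1)[of i] have lt: "s i < Suc j * K" "s i < Suc A * K"
      by linarith+
    have "5 * \<epsilon> \<le> dist ((f ^^ s i) p) q"
      by (rule far)
    also have "\<dots> \<le> dist ((f ^^ s i) p) ((f ^^ s i) (z j))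
        + dist ((f ^^ s i) (z j)) ((f ^^ s i) (z i)) + dist ((f ^^ s i) (z i)) q"
      by (rule dist_quadrangle)
    finally show ?thesis
      using near_q[of i] near_p[OF lt(1)] lt(2) by (simp add: dist_commute)
  qed
  have "\<exists>l<Suc A * K. dist ((f ^^ l) (z i)) ((f ^^ l) (z j)) > 3 * \<epsilon>"
    if "i < A" "j < A" "i \<noteq> j" for i j
    using sep that by (metis dist_commute linorder_neqE_nat)
  moreover have "Suc A * K \<ge> 1"
    using \<open>K \<ge> 1\<close> by simp
  ultimately show ?thesis
    using z by blast
qed

section \<open>Gluing words of segments\<close>

text \<open>The start times do not depend on the word itself, so words with the same gaps are aligned.\<close>

lemma start_time_word:
  assumes "j < length w"
  shows "start_time (map (\<lambda>i. (y i, m)) w) G j = (\<Sum>i<j. m + G ! i - 1)"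
  unfolding start_time_def using assms by (intro sum.cong) auto

text \<open>Each word is sent to the data \<open>(G, t)\<close> of its gluing, which takes at most \<open>(K + 1) ^ k\<close> values on
  \<open>(2 * (K + 1)) ^ k\<close> words; a largest fibre has at least \<open>2 ^ k\<close>
  elements.  Within it, two words are compared at a letter where they differ: of the separation
  \<open>3 * \<epsilon>\<close> of the segments, each of the two shadowing orbits loses at most \<open>\<epsilon>\<close>.\<close>

lemma glued_words:
  fixes X :: "'a::metric_space set"
  assumes glue: "glues_within X f \<epsilon> K" and "\<epsilon> > 0" and "m \<ge> 1" and y: "\<And>i. y i \<in> X"
    and sep: "\<And>i j. i < 2 * (K + 1) \<Longrightarrow> j < 2 * (K + 1) \<Longrightarrow> i \<noteq> j \<Longrightarrow>
                \<exists>l<m. dist ((f ^^ l) (y i)) ((f ^^ l) (y j)) > 3 * \<epsilon>"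
    and "k \<ge> 1"
  shows "\<exists>E n. finite E \<and> 2 ^ k \<le> card E \<and> n \<le> k * (m + K) \<and> separated_set X f n \<epsilon> E \<and>
           (\<forall>z\<in>E. has_period f n z)"
proof -
  let ?C = "\<lambda>w::nat list. map (\<lambda>i. (y i, m)) w"
  define W where "W = {w. set w \<subseteq> {..<2 * (K + 1)} \<and> length w = k}"
  define B where "B = {G. set G \<subseteq> {..K} \<and> length G = k - 1} \<times> {..K}"
  have "\<forall>w\<in>W. \<exists>G t z. t \<le> K \<and> is_gap (?C w) G \<and> set G \<subseteq> {..K} \<and> z \<in> X \<and>
      shadowed f \<epsilon> (?C w) G z \<and> has_period f (start_time (?C w) G (k - 1) + m + t) z"
  proof
    fix w assume "w \<in> W"
    then have "w \<noteq> []" "length w = k"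
      using \<open>k \<ge> 1\<close> by (auto simp: W_def)
    moreover have "orbit_sequence X (?C w)"
      using y \<open>m \<ge> 1\<close> \<open>w \<noteq> []\<close> by (auto simp: orbit_sequence_def)
    moreover obtain t G z where "t \<le> K" "is_gap (?C w) G" "set G \<subseteq> {..K}" "z \<in> X"
      "shadowed f \<epsilon> (?C w) G z"
      "has_period f (start_time (?C w) G (length (?C w) - 1) + snd (last (?C w)) + t) z"
      by (rule glues_withinE[OF glue \<open>orbit_sequence X (?C w)\<close>])
    moreover have "snd (last (?C w)) = m"
      using \<open>w \<noteq> []\<close> by (simp add: last_map)
    ultimately show "\<exists>G t z. t \<le> K \<and> is_gap (?C w) G \<and> set G \<subseteq> {..K} \<and> z \<in> X \<and>
        shadowed f \<epsilon> (?C w) G z \<and> has_period f (start_time (?C w) G (k - 1) + m + t) z"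
      by (intro exI[of _ G] exI[of _ t] exI[of _ z]) simp
  qed
  then obtain G t z where
    t: "\<And>w. w \<in> W \<Longrightarrow> t w \<le> K" and gap: "\<And>w. w \<in> W \<Longrightarrow> is_gap (?C w) (G w)"
    and G: "\<And>w. w \<in> W \<Longrightarrow> set (G w) \<subseteq> {..K}" and z: "\<And>w. w \<in> W \<Longrightarrow> z w \<in> X"
    and shad: "\<And>w. w \<in> W \<Longrightarrow> shadowed f \<epsilon> (?C w) (G w) (z w)"
    and per: "\<And>w. w \<in> W \<Longrightarrow> has_period f (start_time (?C w) (G w) (k - 1) + m + t w) (z w)"
    unfolding bchoice_iff by blast
  have letter: "w ! j < 2 * (K + 1)" if "w \<in> W" "j < k" for w j
  proof -
    have "set w \<subseteq> {..<2 * (K + 1)}" "w ! j \<in> set w"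
      using that by (simp_all add: W_def)
    then show ?thesis by blast
  qed
  have "finite W"
    unfolding W_def by (rule finite_lists_length_eq) simp
  have cardW: "card W = (2 * (K + 1)) ^ k"
    unfolding W_def by (subst card_lists_length_eq) auto
  have "finite B"
    unfolding B_def by (intro finite_cartesian_product finite_lists_length_eq) auto
  have "card B = (K + 1) ^ (k - 1) * (K + 1)"
    unfolding B_def by (simp add: card_cartesian_product card_lists_length_eq)
  also have "\<dots> = (K + 1) ^ k"
    using \<open>k \<ge> 1\<close> by (intro power_minus_mult) simp
  finally have cardB: "card B = (K + 1) ^ k" .
  have "B \<noteq> {}"
    using cardB by (intro notI) simp
  have "(\<lambda>w. (G w, t w)) \<in> W \<rightarrow> B"
    using t G gap by (auto simp: B_def is_gap_def W_def)
  from pigeonhole_card[OF this \<open>finite W\<close> \<open>finite B\<close> \<open>B \<noteq> {}\<close>] obtain G0 t0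
    where b: "(G0, t0) \<in> B"
      "card W \<le> card ((\<lambda>w. (G w, t w)) -` {(G0, t0)} \<inter> W) * card B"
    by auto
  define V where "V = {w \<in> W. G w = G0 \<and> t w = t0}"
  have "(\<lambda>w. (G w, t w)) -` {(G0, t0)} \<inter> W = V"
    by (auto simp: V_def)
  with b(2) cardW cardB have "2 ^ k * (K + 1) ^ k \<le> card V * (K + 1) ^ k"
    by (simp only: power_mult_distrib)
  then have cardV: "2 ^ k \<le> card V"
    by simp
  define S where "S j = (\<Sum>i<j. m + G0 ! i - 1)" for j
  have V: "w \<in> W" "length w = k" "G w = G0" "t w = t0" if "w \<in> V" for w
    using that by (auto simp: V_def W_def)
  have S: "start_time (?C w) G0 j = S j" if "w \<in> V" "j < k" for w j
    using start_time_word[of j w y m G0] that V(2)[OF that(1)] by (simp add: S_def)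
  have near: "dist ((f ^^ (S j + l)) (z w)) ((f ^^ l) (y (w ! j))) < \<epsilon>"
    if "w \<in> V" "j < k" "l < m" for w j l
    using shad[OF V(1)[OF that(1)], unfolded shadowed_def, rule_format, of j l]
      S[OF that(1,2)] V[OF that(1)] that(2,3) by simp
  define n where "n = S (k - 1) + m + t0"
  have "has_period f n (z w)" if "w \<in> V" for w
    using per[of w] V[OF that] S[OF that, of "k - 1"] \<open>k \<ge> 1\<close> by (simp add: n_def)
  moreover have "n \<le> k * (m + K)"
  proof -
    have "set G0 \<subseteq> {..K}" "length G0 = k - 1"
      using b(1) by (auto simp: B_def)
    then have "G0 ! i \<le> K" if "i < k - 1" for i
      using that by (metis atMost_iff nth_mem subsetD)
    then have "S (k - 1) \<le> (\<Sum>i<k - 1. m + K)"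
      unfolding S_def by (intro sum_mono) (simp add: le_diff_conv le_SucI)
    then have "n \<le> (k - 1) * (m + K) + (m + K)"
      using b(1) by (simp add: n_def B_def)
    also have "\<dots> = k * (m + K)"
      using \<open>k \<ge> 1\<close> by (cases k) auto
    finally show ?thesis .
  qed
  moreover have apart: "\<exists>l<n. dist ((f ^^ l) (z v)) ((f ^^ l) (z w)) > \<epsilon>"
    if vw: "v \<in> V" "w \<in> V" "v \<noteq> w" for v w
  proof -
    obtain j where j: "j < k" "v ! j \<noteq> w ! j"
      using vw V(2) by (metis nth_equalityI)
    have "v ! j < 2 * (K + 1)" "w ! j < 2 * (K + 1)"
      using letter V(1,2) vw(1,2) j(1) by blast+
    from sep[OF this j(2)] obtain l
      where l: "l < m" "dist ((f ^^ l) (y (v ! j))) ((f ^^ l) (y (w ! j))) > 3 * \<epsilon>"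
      by blast
    let ?T = "S j + l"
    have "dist ((f ^^ l) (y (v ! j))) ((f ^^ l) (y (w ! j)))
        \<le> dist ((f ^^ l) (y (v ! j))) ((f ^^ ?T) (z v)) + dist ((f ^^ ?T) (z v)) ((f ^^ ?T) (z w))
          + dist ((f ^^ ?T) (z w)) ((f ^^ l) (y (w ! j)))"
      by (rule dist_quadrangle)
    then have "dist ((f ^^ ?T) (z v)) ((f ^^ ?T) (z w)) > \<epsilon>"
      using l(2) near[OF vw(1) j(1) l(1)] near[OF vw(2) j(1) l(1)] by (simp add: dist_commute)
    moreover have "S j \<le> S (k - 1)"
      unfolding S_def using j(1) by (intro sum_mono2) auto
    then have "?T < n"
      using l(1) by (simp add: n_def)
    ultimately show ?thesis by blast
  qed
  moreover have "inj_on z V"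
  proof (rule inj_onI, rule ccontr)
    fix v w assume "v \<in> V" "w \<in> V" "z v = z w" "v \<noteq> w"
    with apart[of v w] \<open>\<epsilon> > 0\<close> show False by auto
  qed
  then have "2 ^ k \<le> card (z ` V)"
    using cardV by (simp add: card_image)
  moreover have "finite (z ` V)"
    using \<open>finite W\<close> by (simp add: V_def)
  moreover have "z ` V \<subseteq> X"
    using z V(1) by blast
  ultimately show ?thesis
    unfolding separated_set_def by (intro exI[of _ "z ` V"] exI[of _ n]) fastforce
qed

section \<open>Exponential growth rates\<close>

lemma ecard_mono:
  assumes "A \<subseteq> B"
  shows "ecard A \<le> ecard B"
  using assms by (auto simp: ecard_def card_mono dest: finite_subset)

text \<open>Along the multiples of \<open>N\<close> the quotients are at least \<open>ln 2 / N\<close>.\<close>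

lemma limsup_growth_pos:
  fixes a :: "nat \<Rightarrow> enat"
  assumes "N \<ge> 1" and a: "\<And>k. k \<ge> 1 \<Longrightarrow> enat (2 ^ k) \<le> a (k * N)"
  shows "limsup (\<lambda>n. ln_enat (a n) / ereal (real n)) > 0"
proof -
  let ?u = "\<lambda>n. ln_enat (a n) / ereal (real n)" and ?r = "\<lambda>k. Suc k * N"
  have "ereal (ln 2 / real N) \<le> ?u (?r k)" for k
  proof -
    have "ereal (real (Suc k) * ln 2) = ln_enat (enat (2 ^ Suc k))"
      by (simp add: ln_enat_def ln_realpow del: power_Suc)
    also have "\<dots> \<le> ln_enat (a (?r k))"
      by (intro ln_enat_mono a) simp
    finally have "ereal (real (Suc k) * ln 2) / ereal (real (?r k)) \<le> ?u (?r k)"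
      using \<open>N \<ge> 1\<close> by (intro ereal_divide_right_mono) (auto intro: add_pos_nonneg)
    moreover have "real (Suc k) * ln 2 / real (?r k) = ln 2 / real N"
      using \<open>N \<ge> 1\<close> by (simp only: of_nat_mult) (simp del: of_nat_Suc)
    moreover have "real (?r k) \<noteq> 0"
      using \<open>N \<ge> 1\<close> by (simp del: of_nat_Suc of_nat_add mult_Suc)
    ultimately show ?thesis
      by (metis ereal_divide)
  qed
  then have "ereal (ln 2 / real N) \<le> limsup (?u \<circ> ?r)"
    by (intro le_Limsup) auto
  also have "\<dots> \<le> limsup ?u"
    using \<open>N \<ge> 1\<close> by (intro limsup_subseq_mono strict_monoI) simp
  finally have "ereal (ln 2 / real N) \<le> limsup ?u" .
  moreover have "0 < ereal (ln 2 / real N)"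
    using \<open>N \<ge> 1\<close> by simp
  ultimately show ?thesis
    by (rule less_le_trans[rotated])
qed

section \<open>Positive entropy and exponential growth of periodic orbits\<close>

theorem corollary1p2:
  fixes X :: "'a::metric_space set" and f :: "'a \<Rightarrow> 'a"
  assumes "compact X" and "X \<noteq> {}"
    and "\<exists>g. homeomorphism X X f g"
    and "periodic_gluing_orbit_property X f"
    and "\<not> single_periodic_orbit X f"
  shows "topological_entropy X f > 0 \<and> periodic_growth X f > 0"
proof -
  have "f ` X \<subseteq> X"
    using assms(3) by (auto simp: homeomorphism_def)
  from periodic_point_off_some_point[OF this assms(2,4,5)] obtain p q \<epsilon>
    where pq: "p \<in> X" "q \<in> X" "\<And>i. dist ((f ^^ i) p) q \<ge> 5 * \<epsilon>" and "\<epsilon> > 0"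
    by metis
  obtain K where K: "K \<ge> 1" "glues_within X f \<epsilon> K"
    using periodic_gluing_imp_glues_within[OF assms(4) \<open>\<epsilon> > 0\<close>] .
  from many_separated_segments[OF K(2,1) pq, of "2 * (K + 1)"] obtain m y
    where m: "m \<ge> 1" and y: "\<And>i. y i \<in> X"
      and sep: "\<And>i j. i < 2 * (K + 1) \<Longrightarrow> j < 2 * (K + 1) \<Longrightarrow> i \<noteq> j \<Longrightarrow>
                \<exists>l<m. dist ((f ^^ l) (y i)) ((f ^^ l) (y j)) > 3 * \<epsilon>"
    by metis
  have "enat (2 ^ k) \<le> separated_number X f (k * (m + K)) \<epsilon>
      \<and> enat (2 ^ k) \<le> ecard (periodic_points_upto X f (k * (m + K)))" if "k \<ge> 1" for k
  proof -
    have "\<exists>E n. finite E \<and> 2 ^ k \<le> card E \<and> n \<le> k * (m + K) \<and> separated_set X f n \<epsilon> E \<and>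
        (\<forall>z\<in>E. has_period f n z)"
      by (rule glued_words[where y = y]) (use K(2) \<open>\<epsilon> > 0\<close> m y sep that in blast)+
    then obtain E n where E: "finite E" "2 ^ k \<le> card E"
      and n: "n \<le> k * (m + K)" and EX: "separated_set X f n \<epsilon> E" "\<forall>z\<in>E. has_period f n z"
      by blast
    have "enat (2 ^ k) \<le> ecard E"
      using E by (simp add: ecard_def)
    moreover have "separated_set X f (k * (m + K)) \<epsilon> E"
      using EX(1) n unfolding separated_set_def by (meson less_le_trans)
    then have "ecard E \<le> separated_number X f (k * (m + K)) \<epsilon>"
      unfolding separated_number_def by (intro SUP_upper) simp
    moreover have "E \<subseteq> periodic_points_upto X f (k * (m + K))"
      using EX n by (auto simp: periodic_points_upto_def separated_set_def)
    then have "ecard E \<le> ecard (periodic_points_upto X f (k * (m + K)))"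
      by (rule ecard_mono)
    ultimately show ?thesis
      by (meson order_trans)
  qed
  moreover have "m + K \<ge> 1"
    using m by simp
  ultimately have "entropy_at_scale X f \<epsilon> > 0" "periodic_growth X f > 0"
    unfolding entropy_at_scale_def periodic_growth_def by (auto intro!: limsup_growth_pos[of "m + K"])
  moreover have "entropy_at_scale X f \<epsilon> \<le> topological_entropy X f"
    unfolding topological_entropy_eq_SUP using \<open>\<epsilon> > 0\<close> by (intro SUP_upper) simp
  ultimately show ?thesis
    by (meson less_le_trans)
qed

end
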